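(* Let $d\in\mathbb N$, let $v_1,\ldots,v_d\in\mathbb R^d$ be linearly independent vectors satisfying $\langle v_i,v_j\rangle=\frac1{\lambda_0}+\frac{\delta_{ij}}{\lambda_i}$ for all $i,j\in\{1,\ldots,d\}$, for some $\lambda_0,\lambda_1,\ldots,\lambda_d\in\mathbb R\setminus\{0\}$, and let $\varepsilon_1,\ldots,\varepsilon_d\in\{\pm1\}$. Then the polar cone of $\operatorname{pos}(\varepsilon_1v_1,\ldots,\varepsilon_dv_d)$ is isometric to $$C_d\bigl(-\lambda_0-\lambda_1-\cdots-\lambda_d;\ \lambda_1,\ldots,\lambda_d;\ \varepsilon_1\operatorname{sgn}(\lambda_1),\ldots,\varepsilon_d\operatorname{sgn}(\lambda_d)\bigr).$$
   Context: $\operatorname{pos}$ denotes the positive hull (all nonnegative linear combinations), $\delta_{ij}$ is the Kronecker delta. The polar cone of $C\subseteq\mathbb R^d$ is $C^\circ=\{v\in\mathbb R^d:\langle v,z\rangle\le0\text{ for all }z\in C\}$. Orthocentric cone: $C_d(\lambda_0;\lambda_1,\ldots,\lambda_d;\varepsilon_1,\ldots,\varepsilon_d):=\operatorname{pos}(\varepsilon_1v_1,\ldots,\varepsilon_dv_d)$, where $v_1,\ldots,v_d$ are linearly independent vectors in some $\mathbb R^N$, $N\ge d$, with $\langle v_i,v_j\rangle=\frac1{\lambda_0}+\frac{\delta_{ij}}{\lambda_i}$ for all $i,j$; here $\lambda_0,\ldots,\lambda_d\in\mathbb R\setminus\{0\}$ and $\varepsilon_i\in\{\pm1\}$. This cone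 is defined up to isometry. It exists exactly when either all $\lambda_0,\ldots,\lambda_d$ are positive, or exactly one of them is negative, all others are positive and $\lambda_0+\cdots+\lambda_d<0$. *)

theory Defs
  imports "HOL-Analysis.Analysis"
begin

definition pos_hull :: "'a::real_vector set \<Rightarrow> 'a set" where
  "pos_hull S = {\<Sum>x\<in>F. c x *\<^sub>R x | F c. finite F \<and> F \<subseteq> S \<and> (\<forall>x\<in>F. (0::real) \<le> c x)}"

lemma pos_hull_eq_convex_cone_hull: "pos_hull S = convex_cone hull S"
proof
  show "pos_hull S \<subseteq> convex_cone hull S"
  proof
    fix y assume "y \<in> pos_hull S"
    then obtain F c where y: "y = (\<Sum>x\<in>F. c x *\<^sub>R x)"
      and F: "finite F" "F \<subseteq> S" "\<forall>x\<in>F. (0::real) \<le> c x"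
      unfolding pos_hull_def by blast
    from F have "(\<Sum>x\<in>F. c x *\<^sub>R x) \<in> convex_cone hull S"
      by (induction F rule: finite_induct)
        (simp_all add: convex_cone_hull_contains_0 convex_cone_hull_add convex_cone_hull_mul hull_inc)
    with y show "y \<in> convex_cone hull S" by simp
  qed
  have "convex_cone (pos_hull S)"
    unfolding convex_cone_iff
  proof (intro conjI ballI allI impI)
    show "0 \<in> pos_hull S"
      unfolding pos_hull_def by (intro CollectI exI[of _ "{}"]) simp
  next
    fix x y assume "x \<in> pos_hull S" "y \<in> pos_hull S"
    then obtain F c G e where x: "x = (\<Sum>x\<in>F. c x *\<^sub>R x)" "finite F" "F \<subseteq> S" "\<forall>x\<in>F. (0::real) \<le> c x"
      and y: "y = (\<Sum>x\<in>G. e x *\<^sub>R x)" "finite G" "G \<subseteq> S" "\<forall>x\<in>G. (0::real) \<le> e x"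
      unfolding pos_hull_def by blast
    define h where "h z = (if z \<in> F then c z else 0) + (if z \<in> G then e z else 0)" for z
    have "x = (\<Sum>z\<in>F \<union> G. (if z \<in> F then c z else 0) *\<^sub>R z)"
      unfolding x(1) by (rule sum.mono_neutral_cong_left) (use x y in auto)
    moreover have "y = (\<Sum>z\<in>F \<union> G. (if z \<in> G then e z else 0) *\<^sub>R z)"
      unfolding y(1) by (rule sum.mono_neutral_cong_left) (use x y in auto)
    ultimately have "x + y = (\<Sum>z\<in>F \<union> G. h z *\<^sub>R z)"
      by (simp add: h_def scaleR_add_left sum.distrib)
    moreover have "finite (F \<union> G)" "F \<union> G \<subseteq> S" "\<forall>z\<in>F \<union> G. 0 \<le> h z"
      using x y by (auto simp: h_def)
    ultimately show "x + y \<in> pos_hull S"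
      unfolding pos_hull_def by blast
  next
    fix x and r :: real assume "x \<in> pos_hull S" and r: "r \<ge> 0"
    then obtain F c where x: "x = (\<Sum>x\<in>F. c x *\<^sub>R x)" "finite F" "F \<subseteq> S" "\<forall>x\<in>F. (0::real) \<le> c x"
      unfolding pos_hull_def by blast
    have "r *\<^sub>R x = (\<Sum>z\<in>F. (r * c z) *\<^sub>R z)"
      by (simp add: x(1) scaleR_sum_right)
    moreover have "\<forall>z\<in>F. 0 \<le> r * c z" using x r by simp
    ultimately show "r *\<^sub>R x \<in> pos_hull S"
      using x(2,3) unfolding pos_hull_def
      by (intro CollectI exI[of _ F] exI[of _ "\<lambda>z. r * c z"]) auto
  qed
  moreover have "S \<subseteq> pos_hull S"
  proof
    fix x assume "x \<in> S"
    then show "x \<in> pos_hull S"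
      unfolding pos_hull_def
      by (intro CollectI exI[of _ "{x}"] exI[of _ "\<lambda>_. 1"]) auto
  qed
  ultimately show "convex_cone hull S \<subseteq> pos_hull S"
    by (simp add: hull_minimal)
qed

definition polar_cone :: "'a::real_inner set \<Rightarrow> 'a set" where
  "polar_cone C = {v. \<forall>z\<in>C. v \<bullet> z \<le> 0}"

(* Linear independence of the family v 1, ..., v d: the members are distinct and form an
   independent set. *)
definition lin_indep_family :: "nat \<Rightarrow> (nat \<Rightarrow> 'a::real_vector) \<Rightarrow> bool" where
  "lin_indep_family d v \<longleftrightarrow> inj_on v {1..d} \<and> independent (v ` {1..d})"

definition orthocentric_gram ::
  "nat \<Rightarrow> real \<Rightarrow> (nat \<Rightarrow> real) \<Rightarrow> (nat \<Rightarrow> 'a::real_inner) \<Rightarrow> bool" where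
  "orthocentric_gram d lam0 lam v \<longleftrightarrow>
     (\<forall>i\<in>{1..d}. \<forall>j\<in>{1..d}. v i \<bullet> v j = 1 / lam0 + (if i = j then 1 else 0) / lam i)"

(* The cone with given parameters is determined only up to isometry, so it is a predicate:
   K is some realisation of it in the ambient space 'a.  Linear independence forces the
   dimension of 'a to be at least d. *)
definition is_orthocentric_cone ::
  "nat \<Rightarrow> real \<Rightarrow> (nat \<Rightarrow> real) \<Rightarrow> (nat \<Rightarrow> real) \<Rightarrow> 'a::euclidean_space set \<Rightarrow> bool" where
  "is_orthocentric_cone d lam0 lam \<epsilon> K \<longleftrightarrow>
     lam0 \<noteq> 0 \<and> (\<forall>i\<in>{1..d}. lam i \<noteq> 0) \<and> (\<forall>i\<in>{1..d}. \<epsilon> i \<in> {-1, 1}) \<and>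
     (\<exists>v. lin_indep_family d v \<and> orthocentric_gram d lam0 lam v \<and>
          K = pos_hull ((\<lambda>i. \<epsilon> i *\<^sub>R v i) ` {1..d}))"

(* Isometry of cones that may lie in different Euclidean spaces: a linear map which is norm
   preserving on the span of the first cone (not necessarily on the whole ambient space,
   whose dimension may exceed that of the target) carries the first cone onto the second. *)
definition isometric_cones :: "'a::euclidean_space set \<Rightarrow> 'b::euclidean_space set \<Rightarrow> bool" where
  "isometric_cones K L \<longleftrightarrow>
     (\<exists>f. linear f \<and> (\<forall>x\<in>span K. norm (f x) = norm x) \<and> f ` K = L)"

end

(* With w = \<Sum>i. lam i * v i and S = lam0 + \<Sum>i. lam i, every v i \<bullet> w equals S / lam0, which
   forces S \<noteq> 0. The vectors w / S - v i are, up to the factors - lam i, the dual basis of v, so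
   with the right signs they generate the polar cone; their Gram matrix is orthocentric
   with parameters - S and lam. *)

theory Submission
  imports Defs
begin

section \<open>Positive hulls of finite families and their polar cones\<close>

lemma pos_hull_image:
  assumes "finite I"
  shows "pos_hull (g ` I) = {\<Sum>i\<in>I. c i *\<^sub>R g i | c. \<forall>i\<in>I. 0 \<le> c i}" (is "_ = ?R")
proof
  \<comment> \<open>Coefficients in \<open>?R\<close> belong to indices, not to vectors, so
    \<open>g\<close> may take repeated values. Passing through the convex cone hull avoids merging
    the coefficients of equal vectors.\<close>
  have "convex_cone ?R"
    unfolding convex_cone_iff
  proof (intro conjI ballI allI impI)
    show "0 \<in> ?R"
      by (intro CollectI exI[of _ "\<lambda>_. 0"]) simp
  next
    fix x y assume "x \<in> ?R" "y \<in> ?R"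
    then obtain a b where "x = (\<Sum>i\<in>I. a i *\<^sub>R g i)" "\<forall>i\<in>I. 0 \<le> a i"
      "y = (\<Sum>i\<in>I. b i *\<^sub>R g i)" "\<forall>i\<in>I. 0 \<le> b i"
      by blast
    then show "x + y \<in> ?R"
      by (intro CollectI exI[of _ "\<lambda>i. a i + b i"]) (simp add: scaleR_add_left sum.distrib)
  next
    fix x and r :: real assume "x \<in> ?R" "0 \<le> r"
    then obtain a where "x = (\<Sum>i\<in>I. a i *\<^sub>R g i)" "\<forall>i\<in>I. 0 \<le> a i"
      by blast
    with \<open>0 \<le> r\<close> show "r *\<^sub>R x \<in> ?R"
      by (intro CollectI exI[of _ "\<lambda>i. r * a i"]) (simp add: scaleR_sum_right)
  qed
  moreover have "g ` I \<subseteq> ?R"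
  proof
    fix x assume "x \<in> g ` I"
    then obtain k where k: "k \<in> I" "x = g k"
      by blast
    have "(\<Sum>i\<in>I. (if i = k then 1 else 0) *\<^sub>R g i) = (\<Sum>i\<in>I. if i = k then g i else 0)"
      by (rule sum.cong) auto
    then have "x = (\<Sum>i\<in>I. (if i = k then 1 else 0) *\<^sub>R g i)"
      using k assms by simp
    then show "x \<in> ?R"
      by (intro CollectI exI[of _ "\<lambda>i. if i = k then 1 else 0"]) simp
  qed
  ultimately show "pos_hull (g ` I) \<subseteq> ?R"
    unfolding pos_hull_eq_convex_cone_hull by (simp add: hull_minimal)
next
  show "?R \<subseteq> pos_hull (g ` I)"
  proof
    fix x assume "x \<in> ?R"
    then obtain a where x: "x = (\<Sum>i\<in>I. a i *\<^sub>R g i)" and a: "\<forall>i\<in>I. 0 \<le> a i"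
      by blast
    have "(\<Sum>i\<in>J. a i *\<^sub>R g i) \<in> convex_cone hull (g ` I)" if "J \<subseteq> I" for J
      using finite_subset[OF that assms] that a
      by (induction J rule: finite_induct)
        (simp_all add: convex_cone_hull_contains_0 convex_cone_hull_add convex_cone_hull_mul hull_inc)
    then show "x \<in> pos_hull (g ` I)"
      unfolding pos_hull_eq_convex_cone_hull x by blast
  qed
qed

lemma pos_hull_linear_image:
  assumes "linear f"
  shows "f ` pos_hull S = pos_hull (f ` S)"
  unfolding pos_hull_eq_convex_cone_hull using convex_cone_hull_linear_image[OF assms] by simp

lemma polar_cone_pos_hull: "polar_cone (pos_hull S) = {x. \<forall>z\<in>S. x \<bullet> z \<le> 0}"
proof
  have "S \<subseteq> pos_hull S"
    by (simp add: pos_hull_eq_convex_cone_hull hull_subset)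
  then show "polar_cone (pos_hull S) \<subseteq> {x. \<forall>z\<in>S. x \<bullet> z \<le> 0}"
    unfolding polar_cone_def by blast
  show "{x. \<forall>z\<in>S. x \<bullet> z \<le> 0} \<subseteq> polar_cone (pos_hull S)"
    unfolding polar_cone_def pos_hull_def
    by (clarsimp simp: inner_sum_right) (intro sum_nonpos mult_nonneg_nonpos, auto)
qed

section \<open>Independent families, spanning families and dual bases\<close>

lemma lin_indep_family_sum_eq_0:
  assumes "lin_indep_family d v" "(\<Sum>i\<in>{1..d}. c i *\<^sub>R v i) = 0" "i \<in> {1..d}"
  shows "c i = 0"
proof -
  \<comment> \<open>Independence of a set takes coefficients on vectors, so the coefficients on
    indices are carried over along the inverse of the injective \<open>v\<close>.\<close>
  let ?u = "\<lambda>x. c (the_inv_into {1..d} v x)"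
  have inj: "inj_on v {1..d}" and ind: "independent (v ` {1..d})"
    using assms(1) by (auto simp: lin_indep_family_def)
  have "(\<Sum>x\<in>v ` {1..d}. ?u x *\<^sub>R x) = (\<Sum>i\<in>{1..d}. c i *\<^sub>R v i)"
    unfolding sum.reindex[OF inj] by (rule sum.cong) (simp_all only: o_def the_inv_into_f_f[OF inj])
  then have "?u (v i) = 0"
    using independentD[OF ind _ order_refl, of ?u "v i"] assms by simp
  then show ?thesis
    by (simp only: the_inv_into_f_f[OF inj assms(3)])
qed

lemma span_lin_indep_family:
  fixes v :: "nat \<Rightarrow> 'a::euclidean_space"
  assumes "lin_indep_family d v" "DIM('a) = d"
  shows "span (v ` {1..d}) = UNIV"
proof -
  have "card (v ` {1..d}) = dim (UNIV :: 'a set)"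
    using assms by (simp add: lin_indep_family_def card_image dim_UNIV)
  then show ?thesis
    using assms(1) card_eq_dim[of "v ` {1..d}" UNIV] by (auto simp: lin_indep_family_def)
qed

text \<open>A spanning set has at least \<open>d\<close> elements and the image of
  \<open>{1..d}\<close> at most \<open>d\<close>. Equality gives injectivity as well as
  independence.\<close>

lemma lin_indep_family_if_spanning:
  fixes y :: "nat \<Rightarrow> 'a::euclidean_space"
  assumes "span (y ` {1..d}) = UNIV" "DIM('a) = d"
  shows "lin_indep_family d y"
proof -
  have le: "card (y ` {1..d}) \<le> d"
    using card_image_le[of "{1..d}" y] by simp
  moreover have "d \<le> card (y ` {1..d})"
    using dim_le_card[of UNIV "y ` {1..d}"] assms by (simp add: dim_UNIV)
  ultimately have "inj_on y {1..d}"
    by (intro eq_card_imp_inj_on) auto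
  moreover have "independent (y ` {1..d})"
    using assms le by (intro card_le_dim_spanning[of _ UNIV]) (auto simp: dim_UNIV)
  ultimately show ?thesis
    by (simp add: lin_indep_family_def)
qed

text \<open>The difference of the two sides is orthogonal to every \<open>v j\<close>, hence to
  their span, which is the whole space, hence to itself.\<close>

lemma dual_basis_expansion:
  fixes v u :: "nat \<Rightarrow> 'a::euclidean_space"
  assumes "span (v ` {1..d}) = UNIV"
    and dual: "\<And>i j. i \<in> {1..d} \<Longrightarrow> j \<in> {1..d} \<Longrightarrow> v i \<bullet> u j = (if i = j then 1 else 0)"
  shows "x = (\<Sum>i\<in>{1..d}. (v i \<bullet> x) *\<^sub>R u i)"
proof -
  let ?z = "x - (\<Sum>i\<in>{1..d}. (v i \<bullet> x) *\<^sub>R u i)"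
  have "orthogonal ?z b" if b: "b \<in> v ` {1..d}" for b
  proof -
    obtain j where j: "j \<in> {1..d}" "b = v j"
      using b by blast
    have "v j \<bullet> (\<Sum>i\<in>{1..d}. (v i \<bullet> x) *\<^sub>R u i) = (\<Sum>i\<in>{1..d}. if i = j then v i \<bullet> x else 0)"
      unfolding inner_sum_right by (rule sum.cong) (use dual j in auto)
    also have "\<dots> = v j \<bullet> x"
      using j by simp
    finally have "v j \<bullet> ?z = 0"
      unfolding inner_diff_right by simp
    then show ?thesis
      by (simp add: orthogonal_def inner_commute j)
  qed
  then have "orthogonal ?z ?z"
    using orthogonal_to_span[of ?z "v ` {1..d}" ?z] assms(1) by blast
  then show ?thesis
    by (simp add: orthogonal_self)
qed

section \<open>The dual family of an orthocentric family\<close>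

lemma orthocentric_gram_inner_sum:
  assumes "orthocentric_gram d lam0 lam v" "\<forall>i\<in>{1..d}. lam i \<noteq> 0" "lam0 \<noteq> 0"
    and "j \<in> {1..d}"
  shows "v j \<bullet> (\<Sum>i\<in>{1..d}. lam i *\<^sub>R v i) = (lam0 + (\<Sum>i\<in>{1..d}. lam i)) / lam0"
proof -
  \<comment> \<open>The weight \<open>lam i\<close> cancels the denominator of the Kronecker term,
    which is why the result does not depend on \<open>j\<close>.\<close>
  have "v j \<bullet> (\<Sum>i\<in>{1..d}. lam i *\<^sub>R v i)
      = (\<Sum>i\<in>{1..d}. lam i / lam0 + (if i = j then 1 else 0))"
    unfolding inner_sum_right
    by (rule sum.cong) (use assms in \<open>auto simp: orthocentric_gram_def algebra_simps\<close>)
  also have "\<dots> = (\<Sum>i\<in>{1..d}. lam i) / lam0 + 1"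
    using assms(4) by (simp add: sum.distrib sum_divide_distrib)
  finally show ?thesis
    using assms(3) by (simp add: add_divide_distrib)
qed

text \<open>The divisor is chosen so that the first term has inner product \<open>1 / lam0\<close>
  with every \<open>v i\<close>. Subtracting \<open>v j\<close> then removes the constant part of
  the Gram entries and leaves only the Kronecker part, negated.\<close>

definition orthocentric_dual ::
  "nat \<Rightarrow> real \<Rightarrow> (nat \<Rightarrow> real) \<Rightarrow> (nat \<Rightarrow> 'a::real_inner) \<Rightarrow> nat \<Rightarrow> 'a" where
  "orthocentric_dual d lam0 lam v j =
     (\<Sum>i\<in>{1..d}. lam i *\<^sub>R v i) /\<^sub>R (lam0 + (\<Sum>i\<in>{1..d}. lam i)) - v j"

context
  fixes v :: "nat \<Rightarrow> 'a::euclidean_space" and d :: nat and lam0 :: real and lam :: "nat \<Rightarrow> real"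
  assumes dim: "DIM('a) = d" and lam0: "lam0 \<noteq> 0" and lam: "\<forall>i\<in>{1..d}. lam i \<noteq> 0"
    and ind: "lin_indep_family d v" and gram: "orthocentric_gram d lam0 lam v"
begin

lemma inner_self_orthocentric_sum:
  "(\<Sum>i\<in>{1..d}. lam i *\<^sub>R v i) \<bullet> (\<Sum>i\<in>{1..d}. lam i *\<^sub>R v i)
    = (\<Sum>i\<in>{1..d}. lam i) * ((lam0 + (\<Sum>i\<in>{1..d}. lam i)) / lam0)" (is "?w \<bullet> _ = _ * ?q")
proof -
  have "?w \<bullet> ?w = (\<Sum>i\<in>{1..d}. lam i * (v i \<bullet> ?w))"
    by (simp add: inner_sum_left)
  also have "\<dots> = (\<Sum>i\<in>{1..d}. lam i * ?q)"
    by (intro sum.cong refl arg_cong2[of _ _ _ _ "(*)"]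
        orthocentric_gram_inner_sum[OF gram lam lam0])
  finally show ?thesis
    unfolding sum_distrib_right .
qed

text \<open>If the sum vanished, the weighted sum of the \<open>v i\<close> would have norm zero,
  which is a linear relation with nonzero coefficients. An index exists because a Euclidean space
  has positive dimension, so \<open>d\<close> is at least 1.\<close>

lemma orthocentric_parameter_sum_nonzero: "lam0 + (\<Sum>i\<in>{1..d}. lam i) \<noteq> 0"
proof
  assume "lam0 + (\<Sum>i\<in>{1..d}. lam i) = 0"
  then have "(\<Sum>i\<in>{1..d}. lam i *\<^sub>R v i) = 0"
    using inner_self_orthocentric_sum by simp
  moreover have "1 \<in> {1..d}"
    using dim DIM_positive[where 'a='a] by simp
  ultimately show False
    using lin_indep_family_sum_eq_0[OF ind] lam by blast
qed

lemma inner_orthocentric_dual: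
  assumes "i \<in> {1..d}" "j \<in> {1..d}"
  shows "v i \<bullet> orthocentric_dual d lam0 lam v j = - (if i = j then 1 else 0) / lam i"
proof -
  have "v i \<bullet> v j = 1 / lam0 + (if i = j then 1 else 0) / lam i"
    using gram assms unfolding orthocentric_gram_def by blast
  then show ?thesis
    unfolding orthocentric_dual_def inner_diff_right inner_scaleR_right
      orthocentric_gram_inner_sum[OF gram lam lam0 assms(1)]
    using orthocentric_parameter_sum_nonzero by (simp add: inverse_eq_divide)
qed

text \<open>Only the left factor of \<open>?y i \<bullet> ?y j\<close> is expanded. As
  \<open>w\<close> has inner product -1 with every \<open>?y j\<close>, its part contributes
  \<open>- 1 / S\<close>; the part \<open>- v i\<close> contributes the Kronecker term by
  duality.\<close>

lemma orthocentric_gram_dual: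
  "orthocentric_gram d (- lam0 - (\<Sum>i\<in>{1..d}. lam i)) lam (orthocentric_dual d lam0 lam v)"
  unfolding orthocentric_gram_def
proof (intro ballI)
  fix i j assume ij: "i \<in> {1..d}" "j \<in> {1..d}"
  define w S where "w = (\<Sum>i\<in>{1..d}. lam i *\<^sub>R v i)" and "S = lam0 + (\<Sum>i\<in>{1..d}. lam i)"
  let ?y = "orthocentric_dual d lam0 lam v"
  have y: "?y k = w /\<^sub>R S - v k" for k
    by (simp add: orthocentric_dual_def w_def S_def)
  have S: "S \<noteq> 0"
    using orthocentric_parameter_sum_nonzero by (simp add: S_def)
  have "w \<bullet> w = (S - lam0) * (S / lam0)"
    using inner_self_orthocentric_sum by (simp add: w_def S_def)
  moreover have "w \<bullet> v j = S / lam0"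
    unfolding w_def S_def inner_commute[of _ "v j"]
    by (rule orthocentric_gram_inner_sum[OF gram lam lam0 ij(2)])
  ultimately have "w \<bullet> ?y j = inverse S * ((S - lam0) * (S / lam0)) - S / lam0"
    unfolding y inner_diff_right inner_scaleR_right by (simp only:)
  also have "\<dots> = - 1"
    using S lam0 by (simp add: field_simps)
  finally have "w \<bullet> ?y j = - 1" .
  then have "?y i \<bullet> ?y j = - 1 / S - v i \<bullet> ?y j"
    by (subst (1) y) (simp add: inner_diff_left inverse_eq_divide)
  also have "- 1 / S = 1 / (- lam0 - (\<Sum>i\<in>{1..d}. lam i))"
    using S unfolding S_def by (simp add: divide_simps)
  finally show "?y i \<bullet> ?y j
      = 1 / (- lam0 - (\<Sum>i\<in>{1..d}. lam i)) + (if i = j then 1 else 0) / lam i"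
    using inner_orthocentric_dual[OF ij] by simp
qed

lemma orthocentric_dual_expansion:
  "x = (\<Sum>i\<in>{1..d}. (- lam i * (v i \<bullet> x)) *\<^sub>R orthocentric_dual d lam0 lam v i)"
proof -
  have "x = (\<Sum>i\<in>{1..d}. (v i \<bullet> x) *\<^sub>R (- lam i) *\<^sub>R orthocentric_dual d lam0 lam v i)"
    by (rule dual_basis_expansion[OF span_lin_indep_family[OF ind dim]])
      (simp only: inner_scaleR_right inner_orthocentric_dual, simp add: lam)
  then show ?thesis
    by (simp only: scaleR_scaleR mult.commute)
qed

text \<open>The expansion shows that these \<open>d\<close> vectors span a space of dimension
  \<open>d\<close>.\<close>

lemma lin_indep_family_orthocentric_dual: "lin_indep_family d (orthocentric_dual d lam0 lam v)"
proof -
  have "x \<in> span (orthocentric_dual d lam0 lam v ` {1..d})" for x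
    by (subst orthocentric_dual_expansion) (intro span_sum span_scale span_base imageI)
  then show ?thesis
    by (intro lin_indep_family_if_spanning[OF _ dim]) blast
qed

end

section \<open>Comparison of realisations and the generators of the polar cone\<close>

lemma norm_sum_cong_gram:
  fixes y :: "nat \<Rightarrow> 'a::real_inner" and z :: "nat \<Rightarrow> 'b::real_inner"
  assumes "orthocentric_gram d l0 lam y" "orthocentric_gram d l0 lam z"
  shows "norm (\<Sum>i\<in>{1..d}. c i *\<^sub>R y i) = norm (\<Sum>i\<in>{1..d}. c i *\<^sub>R z i)"
proof -
  \<comment> \<open>The squared norm is a quadratic form in the coefficients \<open>c\<close>,
    determined by the Gram matrix that both families share.\<close>
  have "(\<Sum>i\<in>{1..d}. \<Sum>j\<in>{1..d}. c i * (c j * (y j \<bullet> y i)))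
      = (\<Sum>i\<in>{1..d}. \<Sum>j\<in>{1..d}. c i * (c j * (z j \<bullet> z i)))"
    by (intro sum.cong refl) (use assms in \<open>simp add: orthocentric_gram_def\<close>)
  then show ?thesis
    by (simp add: norm_eq_sqrt_inner inner_sum_left inner_sum_right sum_distrib_left)
qed

text \<open>The coordinates of \<open>x\<close> along \<open>y\<close> are
  \<open>- lam i * (v i \<bullet> x)\<close>, while the polar cone is cut out by the signs of
  \<open>\<epsilon> i * (v i \<bullet> x)\<close>. Rescaling each \<open>y i\<close> by
  \<open>\<epsilon> i * sgn (lam i)\<close> turns these sign conditions into nonnegative
  coordinates.\<close>

lemma polar_cone_eq_pos_hull_dual:
  fixes v y :: "nat \<Rightarrow> 'a::real_inner"
  assumes lam: "\<And>i. i \<in> {1..d} \<Longrightarrow> lam i \<noteq> 0" and eps: "\<And>i. i \<in> {1..d} \<Longrightarrow> \<epsilon> i \<in> {-1, 1}"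
    and expand: "\<And>x. x = (\<Sum>i\<in>{1..d}. (- lam i * (v i \<bullet> x)) *\<^sub>R y i)"
    and vy: "\<And>i j. i \<in> {1..d} \<Longrightarrow> j \<in> {1..d} \<Longrightarrow> v i \<bullet> y j = - (if i = j then 1 else 0) / lam i"
  shows "polar_cone (pos_hull ((\<lambda>i. \<epsilon> i *\<^sub>R v i) ` {1..d}))
    = pos_hull ((\<lambda>i. (\<epsilon> i * sgn (lam i)) *\<^sub>R y i) ` {1..d})"
proof (intro equalityI subsetI)
  fix x assume "x \<in> polar_cone (pos_hull ((\<lambda>i. \<epsilon> i *\<^sub>R v i) ` {1..d}))"
  then have x: "\<epsilon> i * (v i \<bullet> x) \<le> 0" if "i \<in> {1..d}" for i
    using that by (simp add: polar_cone_pos_hull inner_commute)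
  \<comment> \<open>This is the coordinate along the signed generator: \<open>\<epsilon> i\<close>
    squares to 1 and \<open>\<bar>lam i\<bar> * sgn (lam i)\<close> is \<open>lam i\<close>. Its
    nonnegativity is the polar inequality for \<open>\<epsilon> i *\<^sub>R v i\<close>.\<close>
  define c where "c i = \<bar>lam i\<bar> * - (\<epsilon> i * (v i \<bullet> x))" for i
  have "- lam i * (v i \<bullet> x) = c i * (\<epsilon> i * sgn (lam i))" if "i \<in> {1..d}" for i
    using eps[OF that] by (auto simp: c_def sgn_if)
  then have "x = (\<Sum>i\<in>{1..d}. c i *\<^sub>R (\<epsilon> i * sgn (lam i)) *\<^sub>R y i)"
    by (subst expand) (intro sum.cong, simp_all)
  moreover have "\<forall>i\<in>{1..d}. 0 \<le> c i"
    unfolding c_def using x by (intro ballI mult_nonneg_nonneg) simp_all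
  ultimately show "x \<in> pos_hull ((\<lambda>i. (\<epsilon> i * sgn (lam i)) *\<^sub>R y i) ` {1..d})"
    by (auto simp: pos_hull_image)
next
  fix x assume "x \<in> pos_hull ((\<lambda>i. (\<epsilon> i * sgn (lam i)) *\<^sub>R y i) ` {1..d})"
  then obtain c where x: "x = (\<Sum>i\<in>{1..d}. c i *\<^sub>R (\<epsilon> i * sgn (lam i)) *\<^sub>R y i)"
    and c: "\<forall>i\<in>{1..d}. 0 \<le> c i"
    by (auto simp: pos_hull_image)
  have "\<epsilon> j * (v j \<bullet> x) \<le> 0" if j: "j \<in> {1..d}" for j
  proof -
    have "v j \<bullet> x = (\<Sum>i\<in>{1..d}. if i = j then - c j * (\<epsilon> j * sgn (lam j)) / lam j else 0)"
      unfolding x inner_sum_right by (rule sum.cong) (use vy j in auto)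
    also have "\<dots> = - c j * (\<epsilon> j * sgn (lam j)) / lam j"
      using j by simp
    also have "\<epsilon> j * \<dots> = - (c j / \<bar>lam j\<bar>)"
      using eps[OF j] lam[OF j] by (auto simp: sgn_if)
    finally show ?thesis
      using c j by simp
  qed
  then show "x \<in> polar_cone (pos_hull ((\<lambda>i. \<epsilon> i *\<^sub>R v i) ` {1..d}))"
    by (simp add: polar_cone_pos_hull inner_commute)
qed

text \<open>The polar cone itself serves as the realisation in the first conjunct. The second
  conjunct compares it with every realisation, possibly in a space of another dimension.\<close>

theorem theorem4p2:
  fixes d :: nat
    and v :: "nat \<Rightarrow> real ^ 'n"
    and lam0 :: real
    and lam \<epsilon> :: "nat \<Rightarrow> real"
  assumes "CARD('n) = d"
    and "lam0 \<noteq> 0"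
    and "\<And>i. i \<in> {1..d} \<Longrightarrow> lam i \<noteq> 0"
    and "\<And>i. i \<in> {1..d} \<Longrightarrow> \<epsilon> i \<in> {-1, 1}"
    and "lin_indep_family d v"
    and "orthocentric_gram d lam0 lam v"
  shows "(\<exists>K :: (real ^ 'n) set.
            is_orthocentric_cone d (- lam0 - (\<Sum>i\<in>{1..d}. lam i)) lam (\<lambda>i. \<epsilon> i * sgn (lam i)) K) \<and>
         (\<forall>K :: (real ^ 'm) set.
            is_orthocentric_cone d (- lam0 - (\<Sum>i\<in>{1..d}. lam i)) lam (\<lambda>i. \<epsilon> i * sgn (lam i)) K \<longrightarrow>
            isometric_cones (polar_cone (pos_hull ((\<lambda>i. \<epsilon> i *\<^sub>R v i) ` {1..d}))) K)"
proof -
  let ?l0 = "- lam0 - (\<Sum>i\<in>{1..d}. lam i)" and ?e = "\<lambda>i. \<epsilon> i * sgn (lam i)"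
  let ?P = "polar_cone (pos_hull ((\<lambda>i. \<epsilon> i *\<^sub>R v i) ` {1..d}))"
  define y where "y = orthocentric_dual d lam0 lam v"
  have dim: "DIM(real ^ 'n) = d"
    using assms(1) by simp
  have lam: "\<forall>i\<in>{1..d}. lam i \<noteq> 0"
    using assms(3) by blast
  note hyps = dim assms(2) lam assms(5,6)
  have S: "?l0 \<noteq> 0"
    using orthocentric_parameter_sum_nonzero[OF hyps] by linarith
  note gram = orthocentric_gram_dual[OF hyps, folded y_def]
  note ind = lin_indep_family_orthocentric_dual[OF hyps, folded y_def]
  note expand = orthocentric_dual_expansion[OF hyps, folded y_def]
  note vy = inner_orthocentric_dual[OF hyps, folded y_def]
  have polar: "?P = pos_hull ((\<lambda>i. ?e i *\<^sub>R y i) ` {1..d})"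
    by (rule polar_cone_eq_pos_hull_dual[OF assms(3,4) expand vy])
  have e: "\<forall>i\<in>{1..d}. ?e i \<in> {-1, 1}"
  proof
    fix i assume "i \<in> {1..d}"
    then show "?e i \<in> {-1, 1}"
      using assms(3,4)[of i] by (auto simp: sgn_if)
  qed
  have "is_orthocentric_cone d ?l0 lam ?e ?P"
    unfolding is_orthocentric_cone_def polar using S gram ind e lam by blast
  moreover have "isometric_cones ?P K" if "is_orthocentric_cone d ?l0 lam ?e K"
    for K :: "(real ^ 'm) set"
  proof -
    obtain z where z: "orthocentric_gram d ?l0 lam z"
      and K: "K = pos_hull ((\<lambda>i. ?e i *\<^sub>R z i) ` {1..d})"
      using \<open>is_orthocentric_cone d ?l0 lam ?e K\<close> unfolding is_orthocentric_cone_def by blast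
    \<comment> \<open>The linear map sending each \<open>y i\<close> to \<open>z i\<close>, written
      with the coordinates of \<open>x\<close> along \<open>y\<close> so that it is defined on the
      whole space.\<close>
    define f where "f x = (\<Sum>i\<in>{1..d}. (- lam i * (v i \<bullet> x)) *\<^sub>R z i)" for x
    have lin: "linear f"
      by (rule linearI)
        (simp_all add: f_def inner_add_right algebra_simps sum.distrib sum_subtractf sum_negf
          scaleR_sum_right)
    have fy: "f (y j) = z j" if j: "j \<in> {1..d}" for j
    proof -
      have "f (y j) = (\<Sum>i\<in>{1..d}. if i = j then z i else 0)"
        unfolding f_def by (rule sum.cong) (use vy j assms(3) in auto)
      then show ?thesis
        using j by simp
    qed
    \<comment> \<open>\<open>x\<close> and \<open>f x\<close> have the same coefficients along
      \<open>y\<close> and \<open>z\<close>, and these families have equal Gram matrices.\<close>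
    have "norm (f x) = norm x" for x
      unfolding f_def by (simp only: norm_sum_cong_gram[OF z gram] expand[symmetric])
    moreover have "f ` ?P = K"
      unfolding polar K pos_hull_linear_image[OF lin] image_image
      by (intro arg_cong[of _ _ pos_hull] image_cong refl) (simp only: linear_scale[OF lin] fy)
    ultimately show ?thesis
      unfolding isometric_cones_def using lin by blast
  qed
  ultimately show ?thesis
    by blast
qed

end
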